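(* Every admissible interface scheme (in the sense defined in the context) satisfies $$\|U-u_h\|_\infty\le Ch^2,$$ with $C$ independent of $h$.
   Context: Interface problem: let $a<\alpha<b$, $\beta(x)=\beta^->0$ for $x<\alpha$ and $\beta(x)=\beta^+>0$ for $x>\alpha$ (constants). The exact solution $u$ satisfies $-(\beta u_x)_x=f$ on $(a,\alpha)\cup(\alpha,b)$, $u(a)=u(b)=0$, $[u]_\alpha=w$, $[\beta u_x]_\alpha=v$, where $[g]_\alpha:=g(\alpha^+)-g(\alpha^-)$. Grid: $x_i=a+ih$, $0\le i\le n+1$, $h=(b-a)/(n+1)$, and $x_I<\alpha<x_{I+1}$ with $1\le I\le n-1$ ($I$ depends on $h$). A discretization is written $L_hU=r_h$, $U=(U_1,\ldots,U_n)^T$, where $r_i^h=f(x_i)$ for $i\ne I,I+1$ and $r_I^h,r_{I+1}^h$ may also contain correction terms coming from the jump data. Its truncation error is $\tau:=L_hu_h-r_h$ with $u_h=(u(x_1),\ldots,u(x_n))^T$. A two-node interface discretization is called admissible if: (1) the two interface-adjacent equations (at $x_I$ and $x_{I+1}$) share a single numerical cut-face flux $F^h_{I+\frac12}$, occurring with opposite signs (as $-\frac1hF^h_{I+\frac12}$ in the equation at $x_I$ and $+\frac1hF^h_{I+\frac12}$ in the equation at $x_{I+1}$); (2) the discrete operator has positive face coefficients $\beta_{i+\frac12}>0$, $i=0,\ldots,n$, and the conservative flux form $$(L_hU)_i=\frac1{h^2}\left[-\beta_{i-\frac12}U_{i-1}+(\beta_{i-\frac12}+\beta_{i+\frac12})U_i-\beta_{i+\frac12}U_{i+1}\right],\quad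 1\le i\le n,\quad U_0=U_{n+1}=0,$$ where $\beta_{i+\frac12}\ge\beta_{\min}$ for all $i$ with a constant $\beta_{\min}>0$ independent of $h$; (3) at all ordinary nodes $i\ne I,I+1$, $\tau_i=O(h^2)$; (4) $\tau_I=O(1)$ and $\tau_{I+1}=O(1)$; (5) $\tau_I+\tau_{I+1}=O(h)$. All $O(\cdot)$ are as $h\to0$, with constants independent of $h$ and of the index $i$. $\|\cdot\|_\infty$ is the maximum norm. *)

theory Defs
  imports "HOL-Analysis.Analysis" "HOL-Library.Landau_Symbols"
begin

definition has_jump :: "(real \<Rightarrow> real) \<Rightarrow> real \<Rightarrow> real \<Rightarrow> bool" where
  "has_jump g p c \<longleftrightarrow>
     (\<exists>l r. (g \<longlongrightarrow> l) (at_left p) \<and> (g \<longlongrightarrow> r) (at_right p) \<and> c = r - l)"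

text \<open>The value at the interface \<open>\<alpha>\<close> itself is never used.\<close>

definition pw_coeff :: "real \<Rightarrow> real \<Rightarrow> real \<Rightarrow> real \<Rightarrow> real" where
  "pw_coeff \<alpha> \<beta>m \<beta>p x = (if x < \<alpha> then \<beta>m else \<beta>p)"

definition exact_solution ::
  "real \<Rightarrow> real \<Rightarrow> real \<Rightarrow> real \<Rightarrow> real \<Rightarrow> (real \<Rightarrow> real) \<Rightarrow> real \<Rightarrow> real \<Rightarrow> (real \<Rightarrow> real) \<Rightarrow> bool" where
  "exact_solution a b \<alpha> \<beta>m \<beta>p f w v u \<longleftrightarrow>
     continuous_on ({a..b} - {\<alpha>}) u \<and>
     (\<forall>x \<in> {a<..<\<alpha>} \<union> {\<alpha><..<b}.
        u differentiable at x \<and>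
        ((\<lambda>y. pw_coeff \<alpha> \<beta>m \<beta>p y * deriv u y) has_real_derivative - f x) (at x)) \<and>
     u a = 0 \<and> u b = 0 \<and>
     has_jump u \<alpha> w \<and>
     has_jump (\<lambda>y. pw_coeff \<alpha> \<beta>m \<beta>p y * deriv u y) \<alpha> v"

definition mesh_width :: "real \<Rightarrow> real \<Rightarrow> nat \<Rightarrow> real" where
  "mesh_width a b n = (b - a) / (real n + 1)"

definition grid_point :: "real \<Rightarrow> real \<Rightarrow> nat \<Rightarrow> nat \<Rightarrow> real" where
  "grid_point a b n i = a + real i * mesh_width a b n"

text \<open>
  The family of grids under consideration is indexed by a set \<open>N\<close> of numbers \<open>n\<close> of interior
  nodes, since for some \<open>n\<close> the interface may be a grid point or lie in a boundary cell.
  The limit \<open>h \<rightarrow> 0\<close> is \<open>n \<rightarrow> \<infinity>\<close> within \<open>N\<close>.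
\<close>

definition cut_grids :: "real \<Rightarrow> real \<Rightarrow> real \<Rightarrow> nat set \<Rightarrow> (nat \<Rightarrow> nat) \<Rightarrow> bool" where
  "cut_grids a b \<alpha> N I \<longleftrightarrow>
     (\<forall>n\<in>N. 1 \<le> I n \<and> I n \<le> n - 1 \<and>
        grid_point a b n (I n) < \<alpha> \<and> \<alpha> < grid_point a b n (I n + 1))"

definition refinement :: "nat set \<Rightarrow> nat filter" where
  "refinement N = inf sequentially (principal N)"

text \<open>
  A vector \<open>(V\<^sub>1, \<dots>, V\<^sub>n)\<close> is a function \<open>nat \<Rightarrow> real\<close> of which only the values at
  \<open>1, \<dots>, n\<close> matter; \<open>zero_ext n\<close> implements the convention \<open>V\<^sub>0 = V\<^sub>n\<^sub>+\<^sub>1 = 0\<close>.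
\<close>

definition zero_ext :: "nat \<Rightarrow> (nat \<Rightarrow> real) \<Rightarrow> nat \<Rightarrow> real" where
  "zero_ext n V i = (if 1 \<le> i \<and> i \<le> n then V i else 0)"

definition max_norm :: "nat \<Rightarrow> (nat \<Rightarrow> real) \<Rightarrow> real" where
  "max_norm n V = Max ((\<lambda>i. \<bar>V i\<bar>) ` {1..n})"

definition nodal_values :: "real \<Rightarrow> real \<Rightarrow> (real \<Rightarrow> real) \<Rightarrow> nat \<Rightarrow> nat \<Rightarrow> real" where
  "nodal_values a b u n i = u (grid_point a b n i)"

text \<open>
  A discretization is a family \<open>L n\<close>, \<open>r n\<close> (\<open>n \<in> N\<close>) of operators and right-hand sides,
  standing for the equations \<open>L n U i = r n i\<close>, \<open>i \<in> {1..n}\<close>.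
\<close>

definition discretization ::
  "real \<Rightarrow> real \<Rightarrow> (real \<Rightarrow> real) \<Rightarrow> nat set \<Rightarrow> (nat \<Rightarrow> nat) \<Rightarrow> (nat \<Rightarrow> nat \<Rightarrow> real) \<Rightarrow> bool" where
  "discretization a b f N I r \<longleftrightarrow>
     (\<forall>n\<in>N. \<forall>i \<in> {1..n} - {I n, I n + 1}. r n i = f (grid_point a b n i))"

definition truncation_error ::
  "real \<Rightarrow> real \<Rightarrow> (real \<Rightarrow> real) \<Rightarrow> (nat \<Rightarrow> (nat \<Rightarrow> real) \<Rightarrow> nat \<Rightarrow> real) \<Rightarrow> (nat \<Rightarrow> nat \<Rightarrow> real)
     \<Rightarrow> nat \<Rightarrow> nat \<Rightarrow> real" where
  "truncation_error a b u L r n i = L n (nodal_values a b u n) i - r n i"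

text \<open>In the following, \<open>\<kappa> i\<close> stands for the face coefficient \<open>\<beta>\<close> at \<open>i + 1/2\<close>.\<close>

definition face_flux :: "real \<Rightarrow> nat \<Rightarrow> (nat \<Rightarrow> real) \<Rightarrow> (nat \<Rightarrow> real) \<Rightarrow> nat \<Rightarrow> real" where
  "face_flux h n \<kappa> V i = \<kappa> i * (zero_ext n V (i + 1) - zero_ext n V i) / h"

definition flux_form :: "real \<Rightarrow> nat \<Rightarrow> (nat \<Rightarrow> real) \<Rightarrow> (nat \<Rightarrow> real) \<Rightarrow> nat \<Rightarrow> real" where
  "flux_form h n \<kappa> V i =
     1 / h\<^sup>2 * (- \<kappa> (i - 1) * zero_ext n V (i - 1)
       + (\<kappa> (i - 1) + \<kappa> i) * zero_ext n V i
       - \<kappa> i * zero_ext n V (i + 1))"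

text \<open>
  The interface-adjacent equations \<open>L n V i - r n i = 0\<close>, \<open>i = I, I + 1\<close>, are flux balances
  sharing the numerical cut-face flux \<open>F n V\<close>. This flux may itself contain jump corrections;
  \<open>s n i\<close> collects the source and the corrections that are not part of it (for instance
  a multiple of \<open>v / h\<close>, which cannot be absorbed in a shared flux).
\<close>

definition shared_cut_flux ::
  "real \<Rightarrow> real \<Rightarrow> nat set \<Rightarrow> (nat \<Rightarrow> nat) \<Rightarrow> (nat \<Rightarrow> nat \<Rightarrow> real)
     \<Rightarrow> (nat \<Rightarrow> (nat \<Rightarrow> real) \<Rightarrow> nat \<Rightarrow> real) \<Rightarrow> (nat \<Rightarrow> nat \<Rightarrow> real) \<Rightarrow> bool" where
  "shared_cut_flux a b N I \<kappa> L r \<longleftrightarrow>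
     (\<exists>(F :: nat \<Rightarrow> (nat \<Rightarrow> real) \<Rightarrow> real) (s :: nat \<Rightarrow> nat \<Rightarrow> real). \<forall>n\<in>N. \<forall>V.
        let h = mesh_width a b n in
          L n V (I n) - r n (I n) =
            - (1 / h) * F n V + (1 / h) * face_flux h n (\<kappa> n) V (I n - 1) - s n (I n) \<and>
          L n V (I n + 1) - r n (I n + 1) =
            - (1 / h) * face_flux h n (\<kappa> n) V (I n + 1) + (1 / h) * F n V - s n (I n + 1))"

definition conservative_positive ::
  "real \<Rightarrow> real \<Rightarrow> nat set \<Rightarrow> (nat \<Rightarrow> nat \<Rightarrow> real) \<Rightarrow> (nat \<Rightarrow> (nat \<Rightarrow> real) \<Rightarrow> nat \<Rightarrow> real) \<Rightarrow> bool" where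
  "conservative_positive a b N \<kappa> L \<longleftrightarrow>
     (\<forall>n\<in>N. \<forall>i\<in>{0..n}. \<kappa> n i > 0) \<and>
     (\<exists>\<beta>min>0. \<forall>n\<in>N. \<forall>i\<in>{0..n}. \<kappa> n i \<ge> \<beta>min) \<and>
     (\<forall>n\<in>N. \<forall>V. \<forall>i\<in>{1..n}. L n V i = flux_form (mesh_width a b n) n (\<kappa> n) V i)"

definition admissible ::
  "real \<Rightarrow> real \<Rightarrow> (real \<Rightarrow> real) \<Rightarrow> (real \<Rightarrow> real) \<Rightarrow> nat set \<Rightarrow> (nat \<Rightarrow> nat)
     \<Rightarrow> (nat \<Rightarrow> (nat \<Rightarrow> real) \<Rightarrow> nat \<Rightarrow> real) \<Rightarrow> (nat \<Rightarrow> nat \<Rightarrow> real) \<Rightarrow> bool" where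
  "admissible a b f u N I L r \<longleftrightarrow>
     discretization a b f N I r \<and>
     (\<exists>\<kappa>. shared_cut_flux a b N I \<kappa> L r \<and> conservative_positive a b N \<kappa> L) \<and>
     (let \<tau> = truncation_error a b u L r; h = mesh_width a b in
        (\<exists>C. \<forall>\<^sub>F n in refinement N. \<forall>i \<in> {1..n} - {I n, I n + 1}. \<bar>\<tau> n i\<bar> \<le> C * (h n)\<^sup>2) \<and>
        (\<lambda>n. \<tau> n (I n)) \<in> O[refinement N](\<lambda>_. 1) \<and>
        (\<lambda>n. \<tau> n (I n + 1)) \<in> O[refinement N](\<lambda>_. 1) \<and>
        (\<lambda>n. \<tau> n (I n) + \<tau> n (I n + 1)) \<in> O[refinement N](h))"

end

theory Submission
  imports Defs
begin

text \<open>
  The error \<open>e = U - u\<^sub>h\<close> solves the conservative difference equation \<open>L e = - \<tau>\<close> with zero boundary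
  values, so its undivided face fluxes \<open>\<kappa>\<^sub>j (e\<^sub>j\<^sub>+\<^sub>1 - e\<^sub>j)\<close> change by \<open>h\<^sup>2 \<tau>\<^sub>i\<close> across the node \<open>i\<close>. Hence
  they are, up to one constant, \<open>h\<^sup>2\<close> times the partial sums \<open>T\<^sub>j = \<tau>\<^sub>1 + \<dots> + \<tau>\<^sub>j\<close>, and a second summation
  (the constant being fixed by the boundary values) bounds the error by \<open>2 h\<^sup>2 \<Sum>\<^sub>j \<bar>T\<^sub>j\<bar> / \<kappa>\<^sub>j\<close>;
  this is the lemma \<open>two_point_flux_bound\<close>.

  What matters is therefore the size of the partial sums, not that of \<open>\<tau>\<close> itself. The ordinary nodes
  contribute \<open>n O(h\<^sup>2) = O(h)\<close> to each \<open>T\<^sub>j\<close>. The two interface defects are \<open>O(1)\<close>, but for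
  \<open>j > I\<close> they enter through their sum only, which is \<open>O(h)\<close>: an error of the shared cut-face flux
  cancels from it. Only \<open>T\<^sub>I\<close> sees one of them alone. So the \<open>n + 1\<close> numbers \<open>\<bar>T\<^sub>j\<bar>\<close> are all \<open>O(h)\<close> except for a single one that is
  \<open>O(1)\<close>, their sum is \<open>O(1)\<close> (lemma \<open>sum_abs_partial_sums_dipole\<close>), and the error is \<open>O(h\<^sup>2)\<close>.

  The asymptotic hypotheses control all but finitely many grids; on the remaining ones the quotient of
  error and \<open>h\<^sup>2\<close> is bounded because there are only finitely many of them.
\<close>

text \<open>
  Stability in a negative norm: the datum \<open>t\<close> enters through its partial sums only. The flux through
  the face \<open>0\<close> is unknown, but the condition \<open>e (n + 1) = 0\<close> bounds its contribution by that of the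
  partial sums, whence the factor 2: up to the node \<open>i\<close> a constant flux contributes at most as much
  as it does over the whole interval, where it has to compensate the partial sums exactly.
\<close>

lemma two_point_flux_bound:
  fixes e \<kappa> t :: "nat \<Rightarrow> real"
  assumes pos: "\<And>j. j \<le> n \<Longrightarrow> \<kappa> j > 0"
    and e0: "e 0 = 0" and e_end: "e (n + 1) = 0"
    and balance: "\<And>j. j \<in> {1..n} \<Longrightarrow>
      \<kappa> j * (e (j + 1) - e j) - \<kappa> (j - 1) * (e j - e (j - 1)) = t j"
    and i: "i \<le> n + 1"
  shows "\<bar>e i\<bar> \<le> 2 * (\<Sum>j\<le>n. \<bar>\<Sum>k=1..j. t k\<bar> / \<kappa> j)"
proof -
  define q where "q = \<kappa> 0 * (e 1 - e 0)"
  define T where "T j = (\<Sum>k=1..j. t k)" for j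
  define W where "W i = (\<Sum>j<i. 1 / \<kappa> j)" for i
  define S where "S i = (\<Sum>j<i. T j / \<kappa> j)" for i
  define M where "M = (\<Sum>j\<le>n. \<bar>T j\<bar> / \<kappa> j)"
  have flux: "\<kappa> j * (e (j + 1) - e j) = q + T j" if "j \<le> n" for j
    using that
  proof (induction j)
    case 0
    show ?case by (simp add: q_def T_def)
  next
    case (Suc j)
    then show ?case using balance[of "Suc j"] by (simp add: T_def)
  qed
  have e_eq: "e i = q * W i + S i" if "i \<le> n + 1" for i
    using that
  proof (induction i)
    case 0
    show ?case by (simp add: e0 W_def S_def)
  next
    case (Suc i)
    have "e (Suc i) = e i + (q + T i) / \<kappa> i"
      using flux[of i] pos[of i] Suc.prems by (simp add: field_simps)
    then show ?case
      using Suc by (simp add: W_def S_def algebra_simps add_divide_distrib)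
  qed
  have S_le: "\<bar>S i\<bar> \<le> M" if "i \<le> n + 1" for i
  proof -
    have "\<bar>S i\<bar> \<le> (\<Sum>j<i. \<bar>T j / \<kappa> j\<bar>)"
      unfolding S_def by (rule sum_abs)
    also have "\<dots> = (\<Sum>j<i. \<bar>T j\<bar> / \<kappa> j)"
      using that by (intro sum.cong refl) (simp add: abs_of_pos[OF pos])
    also have "\<dots> \<le> M"
      unfolding M_def
    proof (rule sum_mono2)
      show "0 \<le> \<bar>T j\<bar> / \<kappa> j" if "j \<in> {..n} - {..<i}" for j
        using pos[of j] that by simp
    qed (use that in auto)
    finally show ?thesis .
  qed
  have W_nonneg: "0 \<le> W i" if "i \<le> n + 1" for i
    unfolding W_def
  proof (rule sum_nonneg)
    show "0 \<le> 1 / \<kappa> j" if "j \<in> {..<i}" for j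
      using pos[of j] that \<open>i \<le> n + 1\<close> by simp
  qed
  have W_mono: "W i \<le> W (n + 1)"
    unfolding W_def
  proof (rule sum_mono2)
    show "0 \<le> 1 / \<kappa> j" if "j \<in> {..<n + 1} - {..<i}" for j
      using pos[of j] that by simp
  qed (use i in auto)
  have "\<bar>q * W i\<bar> \<le> \<bar>q * W (n + 1)\<bar>"
    using W_mono W_nonneg[OF i] W_nonneg[of "n + 1"]
    by (simp add: abs_mult mult_left_mono)
  also have "q * W (n + 1) = - S (n + 1)"
    using e_eq[of "n + 1"] e_end by simp
  finally have "\<bar>q * W i\<bar> \<le> M"
    using S_le[of "n + 1"] by simp
  then have "\<bar>e i\<bar> \<le> 2 * M"
    using S_le[OF i] e_eq[OF i] by linarith
  then show ?thesis by (simp add: M_def T_def)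
qed

text \<open>
  A pair of neighbouring entries that nearly cancel acts like a discrete dipole: it is felt at full
  strength \<open>B\<close> by a single partial sum, the one that separates the two entries.
\<close>

lemma sum_abs_partial_sums_dipole:
  fixes \<tau> :: "nat \<Rightarrow> real"
  assumes p: "1 \<le> p" "p \<le> n"
    and ordinary: "\<And>k. k \<in> {1..n} - {p, p + 1} \<Longrightarrow> \<bar>\<tau> k\<bar> \<le> A"
    and "0 \<le> A" and single: "\<bar>\<tau> p\<bar> \<le> B" and pair: "\<bar>\<tau> p + \<tau> (p + 1)\<bar> \<le> D"
  shows "(\<Sum>j\<le>n. \<bar>\<Sum>k=1..j. \<tau> k\<bar>) \<le> (real n + 1) * (real n * A + D) + B"
proof -
  have "\<bar>\<Sum>k=1..j. \<tau> k\<bar> \<le> (real n * A + D) + (if j = p then B else 0)" if "j \<le> n" for j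
  proof -
    let ?P = "{p, p + 1}"
    have split: "(\<Sum>k=1..j. \<tau> k) = (\<Sum>k\<in>{1..j} \<inter> ?P. \<tau> k) + (\<Sum>k\<in>{1..j} - ?P. \<tau> k)"
      by (rule sum.Int_Diff) simp
    have "card ({1..j} - ?P) \<le> n"
      using card_mono[of "{1..j}" "{1..j} - ?P"] that by simp
    moreover have "\<bar>\<Sum>k\<in>{1..j} - ?P. \<tau> k\<bar> \<le> real (card ({1..j} - ?P)) * A"
    proof (rule order_trans[OF sum_abs sum_bounded_above])
      show "\<bar>\<tau> k\<bar> \<le> A" if "k \<in> {1..j} - ?P" for k
        using ordinary[of k] that \<open>j \<le> n\<close> by simp
    qed
    ultimately have far: "\<bar>\<Sum>k\<in>{1..j} - ?P. \<tau> k\<bar> \<le> real n * A"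
      using \<open>0 \<le> A\<close> by (meson mult_right_mono of_nat_le_iff order_trans)
    consider "j < p" | "j = p" | "p < j" by linarith
    then have near: "\<bar>\<Sum>k\<in>{1..j} \<inter> ?P. \<tau> k\<bar> \<le> D + (if j = p then B else 0)"
    proof cases
      case 1
      then have "{1..j} \<inter> ?P = {}" by auto
      then show ?thesis using pair 1 by (simp del: Int_insert_right)
    next
      case 2
      then have "{1..j} \<inter> ?P = {p}" using p by auto
      then show ?thesis using pair single 2 by (simp del: Int_insert_right)
    next
      case 3
      then have "{1..j} \<inter> ?P = ?P" using p by auto
      then show ?thesis using pair 3 by (simp del: Int_insert_right)
    qed
    show ?thesis using split far near by linarith
  qed
  then have "(\<Sum>j\<le>n. \<bar>\<Sum>k=1..j. \<tau> k\<bar>)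
      \<le> (\<Sum>j\<le>n. (real n * A + D) + (if j = p then B else 0))"
    by (intro sum_mono) simp
  also have "\<dots> = (real n + 1) * (real n * A + D) + B"
    using p by (simp add: sum.distrib)
  finally show ?thesis .
qed

text \<open>
  Since \<open>(n + 1) h = l\<close>, the powers of \<open>h\<close> in the bounds \<open>A h\<^sup>2\<close>, \<open>B\<close> and \<open>D h\<close> on the defect are just
  those that cancel the number of summands, and the factor in front of \<open>h\<^sup>2\<close> is the same for all
  grids. Here \<open>V\<close> is the discrete solution and \<open>V'\<close> the vector that leaves the defect \<open>\<tau>\<close>.
\<close>

lemma flux_form_error_bound:
  fixes \<kappa> \<tau> V V' :: "nat \<Rightarrow> real"
  assumes h: "h = l / (real n + 1)" and "0 < l" and "0 < \<beta>"
    and \<kappa>: "\<And>j. j \<le> n \<Longrightarrow> \<beta> \<le> \<kappa> j"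
    and p: "1 \<le> p" "p \<le> n"
    and defect: "\<And>j. j \<in> {1..n} \<Longrightarrow> flux_form h n \<kappa> V' j - flux_form h n \<kappa> V j = \<tau> j"
    and ordinary: "\<And>k. k \<in> {1..n} - {p, p + 1} \<Longrightarrow> \<bar>\<tau> k\<bar> \<le> A * h\<^sup>2"
    and "0 \<le> A" and single: "\<bar>\<tau> p\<bar> \<le> B" and pair: "\<bar>\<tau> p + \<tau> (p + 1)\<bar> \<le> D * h"
    and i: "i \<in> {1..n}"
  shows "\<bar>V i - V' i\<bar> \<le> 2 * (l\<^sup>2 * A + l * D + B) / \<beta> * h\<^sup>2"
proof -
  define e where "e j = zero_ext n V j - zero_ext n V' j" for j
  let ?T = "\<lambda>j. \<Sum>k=1..j. \<tau> k"
  have "0 < h" using h \<open>0 < l\<close> by simp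
  have nh: "(real n + 1) * h = l" using h by simp
  have balance: "\<kappa> j * (e (j + 1) - e j) - \<kappa> (j - 1) * (e j - e (j - 1)) = h\<^sup>2 * \<tau> j"
    if "j \<in> {1..n}" for j
  proof -
    have scaled: "h\<^sup>2 * flux_form h n \<kappa> X j = - \<kappa> (j - 1) * zero_ext n X (j - 1)
        + (\<kappa> (j - 1) + \<kappa> j) * zero_ext n X j - \<kappa> j * zero_ext n X (j + 1)" for X
      using \<open>0 < h\<close> by (simp add: flux_form_def)
    have "h\<^sup>2 * \<tau> j = h\<^sup>2 * flux_form h n \<kappa> V' j - h\<^sup>2 * flux_form h n \<kappa> V j"
      using defect[OF that] by (simp flip: right_diff_distrib)
    then show ?thesis unfolding scaled e_def by (simp add: algebra_simps)
  qed
  have "\<bar>e i\<bar> \<le> 2 * (\<Sum>j\<le>n. \<bar>\<Sum>k=1..j. h\<^sup>2 * \<tau> k\<bar> / \<kappa> j)"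
  proof (rule two_point_flux_bound)
    show "0 < \<kappa> j" if "j \<le> n" for j using \<kappa>[OF that] \<open>0 < \<beta>\<close> by linarith
    show "e 0 = 0" "e (n + 1) = 0" by (simp_all add: e_def zero_ext_def)
  qed (use balance i in auto)
  also have "(\<Sum>j\<le>n. \<bar>\<Sum>k=1..j. h\<^sup>2 * \<tau> k\<bar> / \<kappa> j) \<le> (\<Sum>j\<le>n. h\<^sup>2 / \<beta> * \<bar>?T j\<bar>)"
  proof (rule sum_mono)
    fix j assume "j \<in> {..n}"
    then have "\<beta> \<le> \<kappa> j" using \<kappa> by simp
    then have "\<bar>h\<^sup>2 * ?T j\<bar> / \<kappa> j \<le> \<bar>h\<^sup>2 * ?T j\<bar> / \<beta>"
      using \<open>0 < \<beta>\<close> by (intro divide_left_mono) auto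
    then show "\<bar>\<Sum>k=1..j. h\<^sup>2 * \<tau> k\<bar> / \<kappa> j \<le> h\<^sup>2 / \<beta> * \<bar>?T j\<bar>"
      by (simp add: sum_distrib_left[symmetric] abs_mult)
  qed
  also have "\<dots> = h\<^sup>2 / \<beta> * (\<Sum>j\<le>n. \<bar>?T j\<bar>)"
    by (simp only: sum_distrib_left)
  also have "(\<Sum>j\<le>n. \<bar>?T j\<bar>) \<le> l\<^sup>2 * A + l * D + B"
  proof -
    have "(\<Sum>j\<le>n. \<bar>?T j\<bar>) \<le> (real n + 1) * (real n * (A * h\<^sup>2) + D * h) + B"
      using ordinary single pair \<open>0 \<le> A\<close> by (intro sum_abs_partial_sums_dipole[OF p]) auto
    also have "\<dots> \<le> (real n + 1) * ((real n + 1) * (A * h\<^sup>2) + D * h) + B"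
      using \<open>0 \<le> A\<close> by (intro add_right_mono mult_left_mono mult_right_mono) auto
    also have "\<dots> = ((real n + 1) * h)\<^sup>2 * A + ((real n + 1) * h) * D + B"
      by (simp add: power2_eq_square algebra_simps)
    finally show ?thesis by (simp only: nh)
  qed
  finally have "\<bar>e i\<bar> \<le> 2 * (h\<^sup>2 / \<beta> * (l\<^sup>2 * A + l * D + B))"
    using \<open>0 < \<beta>\<close> by (simp add: mult_left_mono divide_right_mono)
  moreover have "e i = V i - V' i" using i by (simp add: e_def zero_ext_def)
  ultimately show ?thesis by (simp add: algebra_simps add_divide_distrib)
qed

lemma eventually_refinement:
  "eventually P (refinement N) \<longleftrightarrow> (\<exists>n0. \<forall>n\<ge>n0. n \<in> N \<longrightarrow> P n)"
  unfolding refinement_def eventually_inf_principal eventually_sequentially by simp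

lemma eventual_bound_imp_uniform:
  fixes E g :: "nat \<Rightarrow> real"
  assumes ev: "\<forall>\<^sub>F n in refinement N. E n \<le> C * g n" and g: "\<And>n. g n > 0"
  shows "\<exists>C. \<forall>n\<in>N. E n \<le> C * g n"
proof -
  obtain n0 where n0: "\<And>n. n0 \<le> n \<Longrightarrow> n \<in> N \<Longrightarrow> E n \<le> C * g n"
    using ev by (auto simp: eventually_refinement)
  define Q where "Q = insert C ((\<lambda>n. E n / g n) ` {..<n0})"
  have "finite Q" by (simp add: Q_def)
  have "E n \<le> Max Q * g n" if "n \<in> N" for n
  proof (cases "n < n0")
    case True
    then have "E n / g n \<le> Max Q" using \<open>finite Q\<close> by (intro Max_ge) (auto simp: Q_def)
    then show ?thesis using g[of n] by (simp add: pos_divide_le_eq)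
  next
    case False
    then have "E n \<le> C * g n" using n0 that by simp
    also have "\<dots> \<le> Max Q * g n"
      using \<open>finite Q\<close> g[of n] by (intro mult_right_mono Max_ge) (auto simp: Q_def)
    finally show ?thesis .
  qed
  then show ?thesis by blast
qed

theorem corollary5p2:
  fixes a b \<alpha> \<beta>m \<beta>p w v :: real
    and f u :: "real \<Rightarrow> real"
    and N :: "nat set"
    and I :: "nat \<Rightarrow> nat"
    and L :: "nat \<Rightarrow> (nat \<Rightarrow> real) \<Rightarrow> nat \<Rightarrow> real"
    and r U :: "nat \<Rightarrow> nat \<Rightarrow> real"
  assumes "a < \<alpha>" "\<alpha> < b"
    and "\<beta>m > 0" "\<beta>p > 0"
    and "exact_solution a b \<alpha> \<beta>m \<beta>p f w v u"
    and "cut_grids a b \<alpha> N I"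
    and "admissible a b f u N I L r"
    and "\<forall>n\<in>N. \<forall>i\<in>{1..n}. L n (U n) i = r n i"
  shows "\<exists>C. \<forall>n\<in>N. max_norm n (\<lambda>i. U n i - nodal_values a b u n i) \<le> C * (mesh_width a b n)\<^sup>2"
proof -
  let ?h = "mesh_width a b"
  define \<tau> where "\<tau> = truncation_error a b u L r"
  have "a < b" using assms(1,2) by linarith
  then have h_pos: "0 < ?h n" for n by (simp add: mesh_width_def)
  obtain \<kappa> where cons: "conservative_positive a b N \<kappa> L"
    using assms(7) unfolding admissible_def by blast
  then obtain \<beta> where "0 < \<beta>" and \<beta>: "\<forall>n\<in>N. \<forall>j\<in>{0..n}. \<beta> \<le> \<kappa> n j"
    unfolding conservative_positive_def by blast
  then have \<kappa>: "\<beta> \<le> \<kappa> n j" if "n \<in> N" "j \<le> n" for n j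
    using that by simp
  have L: "L n V j = flux_form (?h n) n (\<kappa> n) V j" if "n \<in> N" "j \<in> {1..n}" for n V j
    using cons that unfolding conservative_positive_def by blast
  have "\<exists>C. \<forall>\<^sub>F n in refinement N. \<forall>k \<in> {1..n} - {I n, I n + 1}. \<bar>\<tau> n k\<bar> \<le> C * (?h n)\<^sup>2"
    and O1: "(\<lambda>n. \<tau> n (I n)) \<in> O[refinement N](\<lambda>_. 1)"
    and Oh: "(\<lambda>n. \<tau> n (I n) + \<tau> n (I n + 1)) \<in> O[refinement N](?h)"
    using assms(7) unfolding admissible_def \<tau>_def Let_def by blast+
  then obtain C where
    C: "\<forall>\<^sub>F n in refinement N. \<forall>k \<in> {1..n} - {I n, I n + 1}. \<bar>\<tau> n k\<bar> \<le> C * (?h n)\<^sup>2"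
    by blast
  obtain B where B: "\<forall>\<^sub>F n in refinement N. \<bar>\<tau> n (I n)\<bar> \<le> B"
    using O1 by (elim landau_o.bigE) simp
  obtain D where D: "\<forall>\<^sub>F n in refinement N. \<bar>\<tau> n (I n) + \<tau> n (I n + 1)\<bar> \<le> D * ?h n"
    using Oh h_pos by (elim landau_o.bigE) (simp add: abs_of_pos)
  have on_N: "\<forall>\<^sub>F n in refinement N. n \<in> N"
    by (simp add: eventually_refinement)
  define K where "K = 2 * ((b - a)\<^sup>2 * \<bar>C\<bar> + (b - a) * D + B) / \<beta>"
  have "\<forall>\<^sub>F n in refinement N.
      max_norm n (\<lambda>i. U n i - nodal_values a b u n i) \<le> K * (?h n)\<^sup>2"
    using C B D on_N
  proof eventually_elim
    case (elim n)
    have I: "1 \<le> I n" "I n \<le> n" "1 \<le> n"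
      using assms(6) elim(4) unfolding cut_grids_def by force+
    have "\<bar>U n i - nodal_values a b u n i\<bar> \<le> K * (?h n)\<^sup>2" if "i \<in> {1..n}" for i
      unfolding K_def
    proof (rule flux_form_error_bound[where \<kappa> = "\<kappa> n" and \<tau> = "\<tau> n" and p = "I n"])
      show "?h n = (b - a) / (real n + 1)" by (simp add: mesh_width_def)
      show "flux_form (?h n) n (\<kappa> n) (nodal_values a b u n) j
          - flux_form (?h n) n (\<kappa> n) (U n) j = \<tau> n j" if "j \<in> {1..n}" for j
        using assms(8) elim(4) that L[OF elim(4) that]
        by (simp add: \<tau>_def truncation_error_def flip: L)
      show "\<bar>\<tau> n k\<bar> \<le> \<bar>C\<bar> * (?h n)\<^sup>2" if "k \<in> {1..n} - {I n, I n + 1}" for k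
        using elim(1) that by (meson abs_ge_self mult_right_mono order_trans zero_le_power2)
    qed (use \<open>a < b\<close> \<open>0 < \<beta>\<close> \<kappa>[OF elim(4)] I elim that in auto)
    then show ?case
      using I(3) unfolding max_norm_def by (subst Max_le_iff) auto
  qed
  then show ?thesis
    by (rule eventual_bound_imp_uniform) (use h_pos in \<open>simp add: less_imp_neq[symmetric]\<close>)
qed

end
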